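(* Every axiom of $\mathrm{EqFSCL}$ is derivable in equational logic from $\mathrm{EqMSCL}$, where $\mathrm{EqMSCL}$ consists of (Neg) $\mathsf F=\neg\mathsf T$, (Or) $x\lor_s y=\neg(\neg x\land_s\neg y)$, (Tand) $\mathsf T\land_s x=x$, (Abs) $x\land_s(x\lor_s y)=x$, (Mem) $(x\lor_s y)\land_s z=(\neg x\land_s(y\land_s z))\lor_s(x\land_s z)$; and $\mathrm{EqFSCL}$ consists of (F1) $\mathsf F=\neg\mathsf T$, (F2) $x\lor_s y=\neg(\neg x\land_s\neg y)$, (F3) $\neg\neg x=x$, (F4) $\mathsf T\land_s x=x$, (F5) $x\lor_s\mathsf F=x$, (F6) $\mathsf F\land_s x=\mathsf F$, (F7) $(x\land_s y)\land_s z=x\land_s(y\land_s z)$, (F8) $\neg x\land_s\mathsf F=x\land_s\mathsf F$, (F9) $(x\land_s\mathsf F)\lor_s y=(x\lor_s\mathsf T)\land_s y$, (F10) $(x\land_s y)\lor_s(z\land_s\mathsf F)=(x\lor_s(z\land_s\mathsf F))\land_s(y\lor_s(z\land_s\mathsf F))$.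
   Context: $A$ is a non-empty set of atoms. Terms are built over the signature $\Sigma_{SCL}(A)=\{\land_s,\lor_s,\neg,\mathsf T,\mathsf F\}\cup A$ (atoms and $\mathsf T,\mathsf F$ constants, $\neg$ unary, $\land_s,\lor_s$ binary sequential conjunction/disjunction) with variables. Derivability is derivability in equational logic. *)

theory Defs
  imports Main
begin

text \<open>Terms over the signature \<open>\<Sigma>\<^sub>S\<^sub>C\<^sub>L(A)\<close>. The set \<open>A\<close> of atoms is the type \<open>'a\<close> (types are
  non-empty); the variables form the countably infinite set \<open>{Var n | n. True}\<close> and are
  distinct from the atoms, which are constants.\<close>

datatype 'a scl =
    Var nat
  | Atom 'a
  | TT
  | FF
  | Neg "'a scl"  ("\<not>\<^sub>s _" [80] 80)
  | Conj "'a scl" "'a scl"  (infix "\<and>\<^sub>s" 70)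
  | Disj "'a scl" "'a scl"  (infix "\<or>\<^sub>s" 70)

type_synonym 'a eqn = "'a scl \<times> 'a scl"

abbreviation equation :: "'a scl \<Rightarrow> 'a scl \<Rightarrow> 'a eqn"  (infix "\<approx>" 60)
  where "s \<approx> t \<equiv> (s, t)"

primrec subst :: "(nat \<Rightarrow> 'a scl) \<Rightarrow> 'a scl \<Rightarrow> 'a scl" where
  "subst \<sigma> (Var n) = \<sigma> n"
| "subst \<sigma> (Atom a) = Atom a"
| "subst \<sigma> TT = TT"
| "subst \<sigma> FF = FF"
| "subst \<sigma> (\<not>\<^sub>s t) = \<not>\<^sub>s (subst \<sigma> t)"
| "subst \<sigma> (s \<and>\<^sub>s t) = (subst \<sigma> s) \<and>\<^sub>s (subst \<sigma> t)"
| "subst \<sigma> (s \<or>\<^sub>s t) = (subst \<sigma> s) \<or>\<^sub>s (subst \<sigma> t)"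

inductive derivable :: "'a eqn set \<Rightarrow> 'a eqn \<Rightarrow> bool"  (infix "\<turnstile>" 55)
  for E :: "'a eqn set" where
  axiom: "e \<in> E \<Longrightarrow> E \<turnstile> e"
| refl: "E \<turnstile> t \<approx> t"
| sym: "E \<turnstile> s \<approx> t \<Longrightarrow> E \<turnstile> t \<approx> s"
| trans: "E \<turnstile> s \<approx> t \<Longrightarrow> E \<turnstile> t \<approx> u \<Longrightarrow> E \<turnstile> s \<approx> u"
| substitution: "E \<turnstile> s \<approx> t \<Longrightarrow> E \<turnstile> subst \<sigma> s \<approx> subst \<sigma> t"
| cong_Neg: "E \<turnstile> s \<approx> t \<Longrightarrow> E \<turnstile> \<not>\<^sub>s s \<approx> \<not>\<^sub>s t"
| cong_Conj: "E \<turnstile> s \<approx> t \<Longrightarrow> E \<turnstile> s' \<approx> t' \<Longrightarrow> E \<turnstile> s \<and>\<^sub>s s' \<approx> t \<and>\<^sub>s t'"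
| cong_Disj: "E \<turnstile> s \<approx> t \<Longrightarrow> E \<turnstile> s' \<approx> t' \<Longrightarrow> E \<turnstile> s \<or>\<^sub>s s' \<approx> t \<or>\<^sub>s t'"

text \<open>The axioms are single equations between open terms in the three distinct object variables
  below; their instances arise only through the substitution rule of \<open>\<turnstile>\<close>.\<close>

abbreviation vx :: "'a scl" where "vx \<equiv> Var 0"
abbreviation vy :: "'a scl" where "vy \<equiv> Var 1"
abbreviation vz :: "'a scl" where "vz \<equiv> Var 2"

definition EqMSCL :: "'a eqn set" where
  "EqMSCL = {
    FF \<approx> \<not>\<^sub>s TT,
    vx \<or>\<^sub>s vy \<approx> \<not>\<^sub>s (\<not>\<^sub>s vx \<and>\<^sub>s \<not>\<^sub>s vy),
    TT \<and>\<^sub>s vx \<approx> vx,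
    vx \<and>\<^sub>s (vx \<or>\<^sub>s vy) \<approx> vx,
    (vx \<or>\<^sub>s vy) \<and>\<^sub>s vz \<approx> (\<not>\<^sub>s vx \<and>\<^sub>s (vy \<and>\<^sub>s vz)) \<or>\<^sub>s (vx \<and>\<^sub>s vz)}"

definition EqFSCL :: "'a eqn set" where
  "EqFSCL = {
    FF \<approx> \<not>\<^sub>s TT,
    vx \<or>\<^sub>s vy \<approx> \<not>\<^sub>s (\<not>\<^sub>s vx \<and>\<^sub>s \<not>\<^sub>s vy),
    \<not>\<^sub>s \<not>\<^sub>s vx \<approx> vx,
    TT \<and>\<^sub>s vx \<approx> vx,
    vx \<or>\<^sub>s FF \<approx> vx,
    FF \<and>\<^sub>s vx \<approx> FF,
    (vx \<and>\<^sub>s vy) \<and>\<^sub>s vz \<approx> vx \<and>\<^sub>s (vy \<and>\<^sub>s vz),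
    \<not>\<^sub>s vx \<and>\<^sub>s FF \<approx> vx \<and>\<^sub>s FF,
    (vx \<and>\<^sub>s FF) \<or>\<^sub>s vy \<approx> (vx \<or>\<^sub>s TT) \<and>\<^sub>s vy,
    (vx \<and>\<^sub>s vy) \<or>\<^sub>s (vz \<and>\<^sub>s FF) \<approx> (vx \<or>\<^sub>s (vz \<and>\<^sub>s FF)) \<and>\<^sub>s (vy \<or>\<^sub>s (vz \<and>\<^sub>s FF))}"

end

theory Submission
  imports Defs
begin

text \<open>The argument takes place in an arbitrary algebra satisfying the axioms of \<open>EqMSCL\<close>, and is
  then applied to the quotient of the terms by derivable equality. Once \<open>\<sim> \<sim> x = x\<close> is known, the
  axioms are self-dual. The hard law is associativity: prefixed with \<open>x\<close>, the
  conjunctions \<open>(\<sim> x \<squnion> y) \<sqinter> z\<close>, \<open>(x \<sqinter> y) \<sqinter> z\<close> and \<open>(y \<sqinter> x) \<sqinter> z\<close> all become \<open>x \<sqinter> (y \<sqinter> z)\<close>, and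
  \<open>(x \<sqinter> y) \<sqinter> z\<close> coincides with \<open>(\<sim> x \<squnion> y) \<sqinter> (x \<sqinter> z)\<close>, to which (Mem) applies. The two sides of (F10)
  unfold to the conditional "if \<open>x\<close> then \<open>y \<squnion> c\<close> else \<open>c\<close>" with its two branches in
  opposite orders, and the branches of a conditional commute.\<close>

section \<open>Double negation and duality\<close>

locale mscl =
  fixes tt ff :: 'b
    and neg :: "'b \<Rightarrow> 'b"  ("\<sim> _" [80] 80)
    and conj :: "'b \<Rightarrow> 'b \<Rightarrow> 'b"  (infix "\<sqinter>" 70)
    and disj :: "'b \<Rightarrow> 'b \<Rightarrow> 'b"  (infix "\<squnion>" 70)
  assumes ff_def: "ff = \<sim> tt"
    and disj_def: "x \<squnion> y = \<sim> (\<sim> x \<sqinter> \<sim> y)"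
    and tt_conj: "tt \<sqinter> x = x"
    and absorb: "x \<sqinter> (x \<squnion> y) = x"
    and mem: "(x \<squnion> y) \<sqinter> z = (\<sim> x \<sqinter> (y \<sqinter> z)) \<squnion> (x \<sqinter> z)"
begin

lemma neg_neg: "\<sim> \<sim> x = x"
proof -
  have tt_disj: "tt \<squnion> y = tt" for y
    using absorb[of tt y] by (simp add: tt_conj)
  then have tt_eq: "\<sim> (ff \<sqinter> \<sim> y) = tt" for y
    using disj_def[of tt y] by (simp add: ff_def)
  have tt_eq': "\<sim> (ff \<sqinter> (y \<squnion> z)) = tt" for y z
    by (simp add: disj_def tt_eq)
  have neg_ff: "\<sim> ff = tt"
    using tt_eq'[of ff ff] by (simp add: absorb)
  have unit: "(ff \<sqinter> (y \<sqinter> z)) \<squnion> z = z" for y z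
    using mem[of tt y z] by (simp add: tt_disj tt_conj ff_def)
  \<comment> \<open>By \<open>unit\<close> every \<open>x\<close> is itself a disjunction, so
    \<open>tt_eq'\<close> covers it.\<close>
  have "\<sim> (ff \<sqinter> x) = tt"
    using tt_eq'[of "ff \<sqinter> (tt \<sqinter> x)" x] by (simp add: unit)
  then have "(ff \<sqinter> x) \<squnion> x = \<sim> \<sim> x"
    by (simp add: disj_def tt_conj)
  then show ?thesis
    using unit[of tt x] by (simp add: tt_conj)
qed

lemma neg_ff: "\<sim> ff = tt"
  by (simp add: ff_def neg_neg)

lemma neg_conj: "\<sim> (x \<sqinter> y) = \<sim> x \<squnion> \<sim> y"
  by (simp add: disj_def neg_neg)

lemma neg_disj: "\<sim> (x \<squnion> y) = \<sim> x \<sqinter> \<sim> y"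
  by (simp add: disj_def neg_neg)

end

sublocale mscl \<subseteq> dual: mscl ff tt neg disj conj
proof
  show "tt = \<sim> ff"
    by (simp add: neg_ff)
  show "x \<sqinter> y = \<sim> (\<sim> x \<squnion> \<sim> y)" for x y
    by (simp add: neg_disj neg_neg)
  show "ff \<squnion> x = x" for x
    by (simp add: disj_def neg_ff tt_conj neg_neg)
  show "x \<squnion> (x \<sqinter> y) = x" for x y
    using arg_cong[OF absorb[of "\<sim> x" "\<sim> y"], of neg] by (simp add: neg_conj neg_disj neg_neg)
  show "(x \<sqinter> y) \<squnion> z = (\<sim> x \<squnion> (y \<squnion> z)) \<sqinter> (x \<squnion> z)" for x y z
    using arg_cong[OF mem[of "\<sim> x" "\<sim> y" "\<sim> z"], of neg] by (simp add: neg_conj neg_disj neg_neg)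
qed

section \<open>Units, idempotence, and \<open>ff\<close> behind an argument\<close>

context mscl
begin

lemma ff_conj: "ff \<sqinter> x = ff"
  using absorb[of ff x] by (simp add: dual.tt_conj)

lemma disj_ff: "x \<squnion> ff = x"
  using mem[of ff tt x] by (simp add: neg_ff tt_conj dual.tt_conj ff_conj)

lemma conj_idem: "x \<sqinter> x = x"
  using absorb[of x ff] by (simp add: disj_ff)

end

text \<open>The context is closed and reopened because the duals \<open>dual.\<dots>\<close> of lemmas proved in a context
  become available only after it is closed.\<close>

context mscl
begin

lemma neg_conj_disj: "(\<sim> x \<sqinter> y) \<squnion> x = x \<squnion> y"
  using mem[of x y tt] by (simp add: dual.disj_ff)

lemma disj_conj_disj: "(x \<squnion> y) \<sqinter> (x \<squnion> z) = x \<squnion> (y \<sqinter> (x \<squnion> z))"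
  using mem[of x y "x \<squnion> z"] by (simp add: absorb neg_conj_disj)

lemma disj_tt_conj: "(x \<squnion> tt) \<sqinter> z = (\<sim> x \<sqinter> z) \<squnion> (x \<sqinter> z)"
  using mem[of x tt z] by (simp add: tt_conj)

end

context mscl
begin

lemma neg_conj_self: "\<sim> x \<sqinter> x = x \<sqinter> ff"
  using dual.disj_tt_conj[of x ff] by (simp add: dual.disj_ff disj_ff)

lemma conj_neg_self: "x \<sqinter> \<sim> x = x \<sqinter> ff"
  using dual.neg_conj_disj[of "\<sim> x" x] by (simp add: neg_neg dual.conj_idem neg_conj_self)

lemma neg_conj_ff: "\<sim> x \<sqinter> ff = x \<sqinter> ff"
  using neg_conj_self[of "\<sim> x"] by (simp add: neg_neg conj_neg_self)

lemma conj_ff_disj_conj: "(x \<sqinter> ff) \<squnion> (x \<sqinter> y) = x \<sqinter> y"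
  using mem[of x ff y] by (simp add: disj_ff ff_conj neg_conj_ff)

end

context mscl
begin

lemma conj_left_idem: "x \<sqinter> (x \<sqinter> y) = x \<sqinter> y"
proof -
  have "x \<sqinter> (x \<sqinter> y) = (\<sim> x \<squnion> (x \<sqinter> y)) \<sqinter> x"
    by (simp add: dual.neg_conj_disj)
  \<comment> \<open>Reading the last \<open>x\<close> as
    \<open>x \<squnion> (x \<sqinter> y)\<close> lets the dual of \<open>disj_tt_conj\<close>
    apply.\<close>
  also have "\<dots> = (x \<sqinter> ff) \<squnion> (x \<sqinter> y)"
    using dual.disj_tt_conj[of x "x \<sqinter> y"] by (simp add: dual.absorb)
  finally show ?thesis
    by (simp add: conj_ff_disj_conj)
qed

lemma neg_conj_conj: "\<sim> x \<sqinter> (x \<sqinter> y) = x \<sqinter> ff"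
  using dual.neg_conj_disj[of "\<sim> x" "x \<sqinter> y"] by (simp add: neg_neg dual.absorb conj_neg_self)

lemma conj_neg_conj: "x \<sqinter> (\<sim> x \<sqinter> y) = x \<sqinter> ff"
  using neg_conj_conj[of "\<sim> x" y] by (simp add: neg_neg neg_conj_ff)

lemma disj_tt_conj_conj: "(x \<squnion> tt) \<sqinter> (x \<sqinter> y) = x \<sqinter> y"
  by (simp add: disj_tt_conj neg_conj_conj conj_left_idem conj_ff_disj_conj)

lemma neg_disj_tt: "\<sim> x \<squnion> tt = x \<squnion> tt"
  using arg_cong[OF neg_conj_ff[of x], of neg] by (simp add: neg_conj neg_neg neg_ff)

text \<open>\<open>\<sim> (x \<sqinter> ff)\<close> equals \<open>x \<squnion> tt\<close>, a prefix
  that \<open>x \<sqinter> y\<close> absorbs, so the disjunct \<open>x \<sqinter> ff\<close> may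
  change sides.\<close>

lemma conj_disj_conj_ff: "(x \<sqinter> y) \<squnion> (x \<sqinter> ff) = x \<sqinter> y"
  using neg_conj_disj[of "x \<sqinter> ff" "x \<sqinter> y"]
  by (simp add: neg_conj neg_ff neg_disj_tt disj_tt_conj_conj conj_ff_disj_conj)

lemma conj_right_absorb: "x \<sqinter> (y \<sqinter> x) = x \<sqinter> y"
  using mem[of "\<sim> x" y x]
  by (simp add: neg_neg dual.neg_conj_disj neg_conj_self conj_disj_conj_ff)

end

section \<open>Simplification behind a prefixed argument\<close>

context mscl
begin

lemma conj_neg_disj: "x \<sqinter> (\<sim> x \<squnion> y) = x \<sqinter> y"
  using dual.neg_conj_disj[of x "\<sim> x \<squnion> y"]
  by (simp add: dual.conj_left_idem dual.neg_conj_disj)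

lemma conj_disj_neg: "x \<sqinter> (y \<squnion> \<sim> x) = x \<sqinter> y"
  using dual.neg_conj_disj[of x "y \<squnion> \<sim> x"]
  by (simp add: dual.conj_right_absorb dual.neg_conj_disj)

text \<open>(Mem) splits the inner part along \<open>x\<close>; the prefix \<open>x\<close> reduces
  the branch under \<open>\<sim> x\<close> to \<open>x \<sqinter> ff\<close>.\<close>

lemma conj_disj_conj: "x \<sqinter> ((x \<squnion> y) \<sqinter> z) = x \<sqinter> z"
proof -
  have "x \<sqinter> ((x \<squnion> y) \<sqinter> z) = (x \<sqinter> (\<sim> x \<sqinter> (y \<sqinter> z))) \<squnion> (x \<sqinter> z)"
    using dual.disj_conj_disj[of x "\<sim> x \<sqinter> (y \<sqinter> z)" z] by (simp add: mem)
  then show ?thesis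
    by (simp add: conj_neg_conj conj_ff_disj_conj)
qed

lemma conj_disj_neg_conj: "x \<sqinter> (y \<squnion> (\<sim> x \<sqinter> z)) = x \<sqinter> y"
proof -
  have "x \<sqinter> y = x \<sqinter> ((x \<squnion> \<sim> z) \<sqinter> y)"
    by (simp add: conj_disj_conj)
  \<comment> \<open>\<open>\<sim> x \<sqinter> z\<close> is the negation of
    \<open>x \<squnion> \<sim> z\<close>.\<close>
  also have "(x \<squnion> \<sim> z) \<sqinter> y = (x \<squnion> \<sim> z) \<sqinter> (y \<squnion> (\<sim> x \<sqinter> z))"
    using conj_disj_neg[of "x \<squnion> \<sim> z" y] by (simp add: neg_disj neg_neg)
  finally show ?thesis
    by (simp add: conj_disj_conj)
qed

lemma conj_neg_disj_conj: "x \<sqinter> ((\<sim> x \<squnion> y) \<sqinter> z) = x \<sqinter> (y \<sqinter> z)"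
  using mem[of "\<sim> x" y z] by (simp add: neg_neg conj_disj_neg_conj conj_left_idem)

end

section \<open>Memory and associativity\<close>

context mscl
begin

lemma conj_conj_left: "x \<sqinter> ((x \<sqinter> y) \<sqinter> z) = x \<sqinter> (y \<sqinter> z)"
  using conj_neg_disj_conj[of x "x \<sqinter> y" z] conj_neg_disj_conj[of x y z]
    dual.conj_neg_disj[of "\<sim> x" y]
  by (simp add: neg_neg)

lemma conj_conj_right: "x \<sqinter> ((y \<sqinter> x) \<sqinter> z) = x \<sqinter> (y \<sqinter> z)"
  using conj_neg_disj_conj[of x "y \<sqinter> x" z] conj_neg_disj_conj[of x y z]
    dual.conj_disj_neg[of "\<sim> x" y]
  by (simp add: neg_neg)

text \<open>Trading the inner \<open>x\<close> and then \<open>y\<close> for \<open>?u\<close> makes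
  the repetition adjacent, where left idempotence removes it.\<close>

lemma conj_memory: "x \<sqinter> (y \<sqinter> (x \<sqinter> z)) = x \<sqinter> (y \<sqinter> z)"
proof -
  let ?u = "x \<sqinter> y"
  have "x \<sqinter> (y \<sqinter> (x \<sqinter> z)) = x \<sqinter> (y \<sqinter> (?u \<sqinter> z))"
    by (simp add: conj_conj_right)
  also have "\<dots> = x \<sqinter> (?u \<sqinter> (?u \<sqinter> z))"
    by (simp add: conj_conj_left)
  also have "\<dots> = x \<sqinter> (y \<sqinter> z)"
    by (simp add: conj_left_idem conj_conj_left)
  finally show ?thesis .
qed

lemma disj_conj_conj: "x \<squnion> ((x \<sqinter> y) \<sqinter> z) = x"
  using dual.conj_disj_conj[of x y "(x \<sqinter> y) \<sqinter> z"] by (simp add: dual.absorb)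

text \<open>Once (Mem) unfolds \<open>(x \<sqinter> w) \<sqinter> ff\<close>, \<open>w\<close>
  occurs only in \<open>w \<sqinter> ff\<close>, which is invariant under negating
  \<open>w\<close>.\<close>

lemma conj_neg_right_ff: "(x \<sqinter> \<sim> y) \<sqinter> ff = (x \<sqinter> y) \<sqinter> ff"
proof -
  have "(x \<sqinter> w) \<sqinter> ff = (x \<sqinter> (w \<sqinter> ff)) \<squnion> (\<sim> x \<sqinter> ff)" for w
    using neg_conj_ff[of "x \<sqinter> w"] mem[of "\<sim> x" "\<sim> w" ff]
    by (simp add: neg_conj neg_neg neg_conj_ff)
  then show ?thesis
    by (simp add: neg_conj_ff)
qed

lemma neg_disj_conj_conj: "(\<sim> x \<squnion> y) \<sqinter> (x \<sqinter> z) = (x \<sqinter> y) \<sqinter> z"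
proof -
  \<comment> \<open>With this \<open>?u\<close>, the first factor is \<open>\<sim> ?u\<close> and
    \<open>?v\<close> is \<open>(\<sim> ?u \<sqinter> x) \<sqinter> z\<close>, which
    \<open>\<sim> ?u\<close> absorbs as a disjunct.\<close>
  let ?u = "x \<sqinter> \<sim> y" and ?v = "(x \<sqinter> y) \<sqinter> z"
  have neg_u: "\<sim> ?u = \<sim> x \<squnion> y"
    by (simp add: neg_conj neg_neg)
  have neg_u_conj: "\<sim> ?u \<sqinter> x = x \<sqinter> y"
    unfolding neg_u by (rule dual.neg_conj_disj)
  have "\<sim> ?u \<sqinter> (x \<sqinter> z) = \<sim> ?u \<sqinter> ?v"
    using conj_conj_left[of "\<sim> ?u" x z] by (simp only: neg_u_conj)
  also have "\<dots> = (\<sim> ?u \<squnion> ?v) \<sqinter> ?v"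
    using disj_conj_conj[of "\<sim> ?u" x z] by (simp only: neg_u_conj)
  \<comment> \<open>By (Mem), \<open>?v\<close> now follows both outcomes of
    \<open>?u\<close>.\<close>
  also have "\<dots> = (?u \<squnion> tt) \<sqinter> ?v"
    using mem[of "\<sim> ?u" ?v ?v] disj_tt_conj[of "\<sim> ?u" ?v]
    by (simp only: neg_neg conj_idem neg_disj_tt)
  also have "?u \<squnion> tt = (x \<sqinter> y) \<squnion> tt"
    using arg_cong[OF conj_neg_right_ff[of x y], of neg] neg_disj_tt
    by (simp only: neg_conj[of _ ff] neg_ff)
  also have "((x \<sqinter> y) \<squnion> tt) \<sqinter> ?v = ?v"
    by (rule disj_tt_conj_conj)
  finally show ?thesis
    by (simp only: neg_u)
qed

lemma conj_assoc: "(x \<sqinter> y) \<sqinter> z = x \<sqinter> (y \<sqinter> z)"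
proof -
  have "(x \<sqinter> y) \<sqinter> z = (x \<sqinter> (y \<sqinter> (x \<sqinter> z))) \<squnion> (\<sim> x \<sqinter> (x \<sqinter> z))"
    using mem[of "\<sim> x" y "x \<sqinter> z"] by (simp add: neg_neg neg_disj_conj_conj)
  then show ?thesis
    by (simp add: neg_conj_conj conj_disj_conj_ff conj_memory)
qed

section \<open>Laws of \<open>ff\<close> and of conditionals\<close>

text \<open>Exchanging the disjuncts gives \<open>((x \<squnion> tt) \<sqinter> y) \<squnion> (x
  \<sqinter> ff)\<close>; as \<open>x \<sqinter> ff\<close> is also
  \<open>(x \<squnion> tt) \<sqinter> ff\<close>, it drops out.\<close>

lemma conj_ff_disj: "(x \<sqinter> ff) \<squnion> y = (x \<squnion> tt) \<sqinter> y"
proof -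
  have "(x \<squnion> tt) \<sqinter> ff = x \<sqinter> ff"
    by (simp add: disj_tt_conj neg_conj_ff dual.conj_idem)
  then show ?thesis
    using neg_conj_disj[of "x \<sqinter> ff" y] conj_disj_conj_ff[of "x \<squnion> tt" y]
    by (simp add: neg_conj neg_ff neg_disj_tt)
qed

lemma conj_conj_disj: "x \<sqinter> (y \<sqinter> (x \<squnion> z)) = x \<sqinter> y"
  using conj_memory[of x y "x \<squnion> z"] by (simp add: absorb conj_right_absorb)

text \<open>Both sides express "if \<open>x\<close> then \<open>y\<close> else \<open>z\<close>";
  (Mem) at \<open>\<sim> x\<close> links them.\<close>

lemma neg_disj_conj_disj: "(\<sim> x \<squnion> y) \<sqinter> (x \<squnion> z) = (x \<sqinter> y) \<squnion> (\<sim> x \<sqinter> z)"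
  using mem[of "\<sim> x" y "x \<squnion> z"] conj_neg_disj[of "\<sim> x" z]
  by (simp add: neg_neg conj_conj_disj)

text \<open>Since \<open>x \<squnion> tt = \<sim> x \<squnion> tt\<close>, the conditional \<open>i\<close> may be split along \<open>x\<close> in either order.\<close>
lemma cond_commute: "(x \<sqinter> y) \<squnion> (\<sim> x \<sqinter> z) = (\<sim> x \<sqinter> z) \<squnion> (x \<sqinter> y)"
proof -
  define i where "i = (\<sim> x \<squnion> y) \<sqinter> (x \<squnion> z)"
  have "x \<sqinter> i = x \<sqinter> y"
    unfolding i_def by (simp add: conj_neg_disj_conj conj_conj_disj conj_neg_disj)
  moreover have "\<sim> x \<sqinter> i = \<sim> x \<sqinter> z"
    unfolding i_def using conj_neg_disj[of "\<sim> x" z] by (simp add: conj_disj_conj neg_neg)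
  \<comment> \<open>\<open>i\<close> starts with \<open>\<sim> x \<squnion> y\<close>, which absorbs
    this prefix.\<close>
  moreover have "(x \<squnion> tt) \<sqinter> i = i"
    unfolding i_def using dual.conj_ff_disj_conj[of "\<sim> x" y]
    by (simp add: neg_disj_tt flip: conj_assoc)
  ultimately show ?thesis
    using disj_tt_conj[of x i] by (simp add: i_def neg_disj_conj_disj)
qed

lemma conj_disj_distrib_ff:
  "(x \<sqinter> y) \<squnion> (z \<sqinter> ff) = (x \<squnion> (z \<sqinter> ff)) \<sqinter> (y \<squnion> (z \<sqinter> ff))"
proof -
  let ?c = "z \<sqinter> ff"
  have "(x \<sqinter> y) \<squnion> ?c = (x \<sqinter> (y \<squnion> ?c)) \<squnion> (\<sim> x \<sqinter> ?c)"
    using dual.mem[of x y ?c] by (simp only: neg_disj_conj_disj)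
  also have "\<dots> = (\<sim> x \<sqinter> ?c) \<squnion> (x \<sqinter> (y \<squnion> ?c))"
    by (rule cond_commute)
  \<comment> \<open>\<open>?c\<close> ends in \<open>ff\<close>, so
    \<open>?c \<sqinter> w = ?c\<close> for every \<open>w\<close>.\<close>
  also have "\<dots> = (x \<squnion> ?c) \<sqinter> (y \<squnion> ?c)"
    by (simp add: mem conj_assoc ff_conj)
  finally show ?thesis .
qed

end

section \<open>From the quotient algebra back to derivability\<close>

lemma derivable_equivp: "equivp (\<lambda>s t. EqMSCL \<turnstile> s \<approx> t)"
  by (rule equivpI) (auto intro: reflpI sympI transpI derivable.refl derivable.sym derivable.trans)

quotient_type 'a mscl_term = "'a scl" / "\<lambda>s t. EqMSCL \<turnstile> s \<approx> t"
  by (rule derivable_equivp)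

lift_definition q_tt :: "'a mscl_term" is TT .

lift_definition q_ff :: "'a mscl_term" is FF .

lift_definition q_neg :: "'a mscl_term \<Rightarrow> 'a mscl_term" is Neg
  by (rule derivable.cong_Neg)

lift_definition q_conj :: "'a mscl_term \<Rightarrow> 'a mscl_term \<Rightarrow> 'a mscl_term" is Conj
  by (rule derivable.cong_Conj)

lift_definition q_disj :: "'a mscl_term \<Rightarrow> 'a mscl_term \<Rightarrow> 'a mscl_term" is Disj
  by (rule derivable.cong_Disj)

lemma axiom_instance:
  "s \<approx> t \<in> E \<Longrightarrow> E \<turnstile> subst \<sigma> s \<approx> subst \<sigma> t"
  by (intro derivable.substitution derivable.axiom)

interpretation q: mscl q_tt q_ff q_neg q_conj q_disj
proof
  \<comment> \<open>Every index above 1 goes to \<open>z\<close>; axioms in fewer variables take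
    \<open>x\<close> as a filler.\<close>
  define \<sigma> :: "'a scl \<Rightarrow> 'a scl \<Rightarrow> 'a scl \<Rightarrow> nat \<Rightarrow> 'a scl"
    where "\<sigma> x y z = (\<lambda>n. if n = 0 then x else if n = 1 then y else z)" for x y z
  note inst = axiom_instance[where E = EqMSCL and \<sigma> = "\<sigma> x y z" for x y z]
  show "q_ff = q_neg (q_tt :: 'a mscl_term)"
    by transfer (rule derivable.axiom, simp add: EqMSCL_def)
  show "q_disj x y = q_neg (q_conj (q_neg x) (q_neg y))" for x y :: "'a mscl_term"
    apply transfer
    subgoal for x y
      using inst[of "vx \<or>\<^sub>s vy" "\<not>\<^sub>s (\<not>\<^sub>s vx \<and>\<^sub>s \<not>\<^sub>s vy)" x y x] by (simp add: EqMSCL_def \<sigma>_def)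
    done
  show "q_conj q_tt x = x" for x :: "'a mscl_term"
    apply transfer
    subgoal for x
      using inst[of "TT \<and>\<^sub>s vx" vx x x x] by (simp add: EqMSCL_def \<sigma>_def)
    done
  show "q_conj x (q_disj x y) = x" for x y :: "'a mscl_term"
    apply transfer
    subgoal for x y
      using inst[of "vx \<and>\<^sub>s (vx \<or>\<^sub>s vy)" vx x y x] by (simp add: EqMSCL_def \<sigma>_def)
    done
  show "q_conj (q_disj x y) z = q_disj (q_conj (q_neg x) (q_conj y z)) (q_conj x z)"
    for x y z :: "'a mscl_term"
    apply transfer
    subgoal for x y z
      using inst[of "(vx \<or>\<^sub>s vy) \<and>\<^sub>s vz" "(\<not>\<^sub>s vx \<and>\<^sub>s (vy \<and>\<^sub>s vz)) \<or>\<^sub>s (vx \<and>\<^sub>s vz)" x y z]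
      by (simp add: EqMSCL_def \<sigma>_def)
    done
qed

theorem theorem3p4:
  fixes e :: "'a eqn"
  assumes "e \<in> EqFSCL"
  shows "EqMSCL \<turnstile> e"
  using assms unfolding EqFSCL_def
  \<comment> \<open>Untransferred, each quotient law is a derivability statement about arbitrary
    terms, here instantiated with the object variables.\<close>
  by (elim insertE emptyE; hypsubst)
    (rule q.ff_def[untransferred] q.disj_def[untransferred] q.neg_neg[untransferred]
      q.tt_conj[untransferred] q.disj_ff[untransferred] q.ff_conj[untransferred]
      q.conj_assoc[untransferred] q.neg_conj_ff[untransferred] q.conj_ff_disj[untransferred]
      q.conj_disj_distrib_ff[untransferred])+

end
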